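(* $s(n)=n(1-o(1))$ as $n\to\infty$; that is, $\lim_{n\to\infty} s(n)/n=1$, where $s(n)$ is the maximum of $\mathit{shift}(G)$ over all plane graphs $G$ with $n$ vertices.
   Context: Graphs are finite and simple. A plane graph $G$ is an abstract planar graph together with a plane embedding (drawing) of it: vertices are distinct points of $\mathbb{R}^2$, and edges are simple curves joining their endpoints which do not cross, i.e. an edge contains no vertices other than its endpoints and two edges meet only in common endpoints. A straight line plane drawing is one in which every edge is a straight line segment. For a plane graph $G$, consider all redrawings of $G$, i.e. all straight line plane drawings $G'$ in $\mathbb{R}^2$ of the same abstract graph (on the same vertex set; $G'$ need not be topologically equivalent to $G$). $\mathit{shift}(G)$ denotes the smallest number $s$ such that there is such a redrawing $G'$ in which exactly $s$ vertices have a location different from their location in $G$ (all other vertices keep their location). For a positive integer $n$, $s(n)$ denotes the maximum of $\mathit{shift}(G)$ over all plane graphs $G$ with $n$ vertices. *)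

theory Defs
  imports "HOL-Analysis.Analysis"
begin

(* An edge is a two-element set of vertices. The values of loc outside verts and of curve
   outside edges are irrelevant. *)
record 'a drawing =
  verts :: "'a set"
  edges :: "'a set set"
  loc :: "'a \<Rightarrow> real^2"
  curve :: "'a set \<Rightarrow> real \<Rightarrow> real^2"

definition simple_graph :: "'a set \<Rightarrow> 'a set set \<Rightarrow> bool" where
  "simple_graph V E \<longleftrightarrow> finite V \<and> (\<forall>e\<in>E. e \<subseteq> V \<and> card e = 2)"

definition plane_graph :: "('a, 'b) drawing_scheme \<Rightarrow> bool" where
  "plane_graph G \<longleftrightarrow>
     simple_graph (verts G) (edges G) \<and>
     inj_on (loc G) (verts G) \<and>
     (\<forall>e\<in>edges G.
        arc (curve G e) \<and>
        {pathstart (curve G e), pathfinish (curve G e)} = loc G ` e \<and>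
        path_image (curve G e) \<inter> loc G ` verts G \<subseteq> loc G ` e) \<and>
     (\<forall>e\<in>edges G. \<forall>f\<in>edges G. e \<noteq> f \<longrightarrow>
        path_image (curve G e) \<inter> path_image (curve G f) \<subseteq> loc G ` (e \<inter> f))"

definition straight_line :: "('a, 'b) drawing_scheme \<Rightarrow> bool" where
  "straight_line G \<longleftrightarrow>
     (\<forall>u v. {u, v} \<in> edges G \<longrightarrow>
        path_image (curve G {u, v}) = closed_segment (loc G u) (loc G v))"

definition straight_line_redrawing :: "'a drawing \<Rightarrow> 'a drawing \<Rightarrow> bool" where
  "straight_line_redrawing G G' \<longleftrightarrow>
     plane_graph G' \<and> straight_line G' \<and> verts G' = verts G \<and> edges G' = edges G"

definition moved :: "'a drawing \<Rightarrow> 'a drawing \<Rightarrow> 'a set" where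
  "moved G G' = {v \<in> verts G. loc G' v \<noteq> loc G v}"

(* By the Wagner-Fary-Stein theorem every plane graph has a straight line redrawing, so LEAST
   denotes an attained minimum whenever plane_graph G holds. *)
definition shift :: "'a drawing \<Rightarrow> nat" where
  "shift G = (LEAST s. \<exists>G'. straight_line_redrawing G G' \<and> card (moved G G') = s)"

(* Vertices are taken from nat; as shift does not depend on the names of the vertices, this
   covers all finite plane graphs. *)
definition max_shift :: "nat \<Rightarrow> nat" where
  "max_shift n = Max {shift G | G :: nat drawing. plane_graph G \<and> card (verts G) = n}"

(* The maximum in max_shift ranges over a finite nonempty set. *)

lemma shift_le_card_verts:
  assumes "plane_graph G" "straight_line_redrawing G G'"
  shows "shift G \<le> card (verts G)"
proof -
  have "finite (verts G)"
    using assms(1) by (simp add: plane_graph_def simple_graph_def)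
  then have "card (moved G G') \<le> card (verts G)"
    by (intro card_mono) (auto simp: moved_def)
  moreover have "shift G \<le> card (moved G G')"
    unfolding shift_def using assms(2) by (intro Least_le) blast
  ultimately show ?thesis by linarith
qed

lemma finite_shifts:
  "finite {shift G | G :: nat drawing. plane_graph G \<and> card (verts G) = n}"
proof (rule finite_subset)
  show "{shift G | G :: nat drawing. plane_graph G \<and> card (verts G) = n}
      \<subseteq> insert (LEAST s. False) {..n}"
  proof clarsimp
    fix G :: "nat drawing"
    assume G: "plane_graph G" and "shift G \<noteq> (LEAST s. False)"
    then have "\<exists>G'. straight_line_redrawing G G'"
      unfolding shift_def by metis
    then show "shift G \<le> card (verts G)"
      using G shift_le_card_verts by blast
  qed
qed simp

lemma shifts_nonempty:
  "{shift G | G :: nat drawing. plane_graph G \<and> card (verts G) = n} \<noteq> {}"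
proof -
  define G :: "nat drawing" where
    "G = \<lparr>verts = {..<n}, edges = {}, loc = (\<lambda>v. of_nat v), curve = (\<lambda>_ _. 0)\<rparr>"
  have "plane_graph G" "card (verts G) = n"
    by (auto simp: G_def plane_graph_def simple_graph_def inj_on_def)
  then show ?thesis by blast
qed

end

theory Submission
  imports Defs "HOL-Real_Asymp.Real_Asymp"
begin

text \<open>
  Take \<open>k\<close> disjoint stars and number their vertices so that \<open>v\<close> is adjacent to its centre
  \<open>v mod k\<close>. A homeomorphism of the plane turns a straight line drawing of this forest into a plane
  graph that has vertex \<open>v\<close> at \<open>(v, 0)\<close>, so that the leaves of the stars appear on the axis in
  round-robin order. In a straight line redrawing, two stars whose centres lie on the same side of
  the axis cannot both keep their leaves of rounds \<open>r < r'\<close>: these four leaves alternate, so the two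
  wedges from the leaves to the centres would meet. Hence each pair of rounds is kept by at most two
  stars, which leaves at most \<open>2k + O((n/k)\<^sup>2)\<close> vertices in place; choose \<open>k\<close> about \<open>n\<^bsup>2/3\<^esup>\<close>.
\<close>

section \<open>Crossing wedges\<close>

lemma axis_point_in_closed_segment:
  fixes P :: "real^2"
  assumes "P $ 2 = 0" "u \<le> x \<and> x \<le> P $ 1 \<or> P $ 1 \<le> x \<and> x \<le> u"
  shows "vector [x, 0] \<in> closed_segment (vector [u, 0]) P"
proof (cases "P $ 1 = u")
  case True
  then have "vector [x, 0] = P"
    using assms by (auto simp: vec_eq_iff forall_2)
  then show ?thesis by simp
next
  case False
  define t where "t = (x - u) / (P $ 1 - u)"
  have "0 \<le> t" "t \<le> 1"
    using assms(2) False by (auto simp: t_def divide_simps)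
  moreover have "t * (P $ 1 - u) = x - u"
    using False by (simp add: t_def)
  then have "vector [x, 0] = (1 - t) *\<^sub>R vector [u, 0] + t *\<^sub>R P"
    using assms(1) by (simp add: vec_eq_iff forall_2 algebra_simps)
  ultimately show ?thesis by (auto simp: in_segment)
qed

lemma on_side_of_triangle:
  fixes X P :: "real^2" and a c s :: real
  defines "p \<equiv> s * P $ 2" and "y \<equiv> s * X $ 2"
  assumes "s \<noteq> 0" "p > 0" "y \<ge> 0"
    and on_line: "(X $ 1 - a) * p = y * (P $ 1 - a)"
    and inner: "(a < c \<and> y * (c - P $ 1) \<le> (c - X $ 1) * p) \<or>
      (c < a \<and> (c - X $ 1) * p \<le> y * (c - P $ 1))"
  shows "X \<in> closed_segment (vector [a, 0]) P"
proof -
  define t where "t = y / p"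
  have y: "y = t * p" using assms(4) by (simp add: t_def)
  have "(X $ 1 - a) * p = (t * (P $ 1 - a)) * p"
    using on_line y by (simp add: algebra_simps)
  then have x: "X $ 1 - a = t * (P $ 1 - a)"
    using \<open>p > 0\<close> by (simp only: mult_cancel_right) auto
  have "(c - X $ 1) * p - y * (c - P $ 1) = (c - a) * (1 - t) * p"
  proof -
    have "c - X $ 1 = c - a - t * (P $ 1 - a)" using x by simp
    show ?thesis unfolding y \<open>c - X $ 1 = _\<close> by (simp add: algebra_simps)
  qed
  then have "(a < c \<and> 0 \<le> (c - a) * (1 - t) * p) \<or> (c < a \<and> (c - a) * (1 - t) * p \<le> 0)"
    using inner by auto
  then have "t \<le> 1"
    using \<open>p > 0\<close> by (auto simp: zero_le_mult_iff mult_le_0_iff)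
  moreover have "0 \<le> t" using \<open>0 < p\<close> \<open>0 \<le> y\<close> unfolding t_def by (rule divide_nonneg_pos[rotated])
  moreover have "X $ 2 = t * P $ 2"
    using y \<open>s \<noteq> 0\<close> by (simp add: p_def y_def)
  then have "X = (1 - t) *\<^sub>R vector [a, 0] + t *\<^sub>R P"
    using x by (simp add: vec_eq_iff forall_2 algebra_simps)
  ultimately show ?thesis by (auto simp: in_segment)
qed

text \<open>The sign \<open>s\<close> covers both half planes at once.\<close>

lemma alternating_wedges_meet:
  fixes P Q :: "real^2" and a b c d s :: real
  assumes "a < b" "b < c" "c < d" "s \<noteq> 0" "0 \<le> s * P $ 2" "0 \<le> s * Q $ 2"
  shows "(closed_segment (vector [a, 0]) P \<union> closed_segment (vector [c, 0]) P) \<inter>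
         (closed_segment (vector [b, 0]) Q \<union> closed_segment (vector [d, 0]) Q) \<noteq> {}"
proof (cases "P $ 2 = 0 \<or> Q $ 2 = 0")
  case True
  then show ?thesis
  proof
    assume "P $ 2 = 0"
    \<comment> \<open>With its apex on the axis, the wedge covers the axis from \<open>a\<close> to
      \<open>P\<close> and from \<open>P\<close> to \<open>c\<close>, hence all points between
      \<open>a\<close> and \<open>c\<close>.\<close>
    then have "vector [b, 0] \<in> closed_segment (vector [a, 0]) P \<union> closed_segment (vector [c, 0]) P"
      using axis_point_in_closed_segment[of P a b] axis_point_in_closed_segment[of P c b] assms
      by (cases "b \<le> P $ 1") auto
    then show ?thesis by auto
  next
    assume "Q $ 2 = 0"
    then have "vector [c, 0] \<in> closed_segment (vector [b, 0]) Q \<union> closed_segment (vector [d, 0]) Q"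
      using axis_point_in_closed_segment[of Q b c] axis_point_in_closed_segment[of Q d c] assms
      by (cases "c \<le> Q $ 1") auto
    then show ?thesis by auto
  qed
next
  case False
  define p where "p = s * P $ 2"
  have "p > 0" using False assms by (auto simp: p_def less_le)
  \<comment> \<open>\<open>f\<close> and \<open>g\<close> are affine, vanish on the lines from
    \<open>P\<close> to (a, 0) and to (c, 0), and are nonnegative on the triangle. So
    \<open>min (f X) (g X)\<close> is positive at (b, 0), negative at (d, 0), and has a zero on the
    connected wedge \<open>S\<close>.\<close>
  define f where "f X = (X $ 1 - a) * p - s * X $ 2 * (P $ 1 - a)" for X :: "real^2"
  define g where "g X = (c - X $ 1) * p - s * X $ 2 * (c - P $ 1)" for X :: "real^2"
  define S where "S = closed_segment (vector [b, 0]) Q \<union> closed_segment (vector [d, 0]) Q"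
  have "connected S"
    unfolding S_def by (intro connected_Un) auto
  moreover have "continuous_on S (\<lambda>X. min (f X) (g X))"
    unfolding f_def g_def by (intro continuous_intros)
  ultimately have "connected ((\<lambda>X. min (f X) (g X)) ` S)"
    by (rule connected_continuous_image[rotated])
  moreover have "min (f (vector [b, 0])) (g (vector [b, 0])) > 0"
    "min (f (vector [d, 0])) (g (vector [d, 0])) < 0"
    using assms \<open>p > 0\<close> by (auto simp: f_def g_def mult_less_0_iff min_less_iff_disj)
  moreover have "vector [b, 0] \<in> S" "vector [d, 0] \<in> S"
    by (auto simp: S_def)
  ultimately have "0 \<in> (\<lambda>X. min (f X) (g X)) ` S"
    by (meson connectedD_interval imageI less_imp_le)
  then obtain X where X: "X \<in> S" "min (f X) (g X) = 0" by force
  \<comment> \<open>Beyond the axis a zero could lie on a side of the triangle prolonged past its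
    base; \<open>S\<close> never goes there.\<close>
  have "\<exists>t. 0 \<le> t \<and> X $ 2 = t * Q $ 2"
    using X(1) by (auto simp: S_def in_segment)
  then have "0 \<le> s * X $ 2"
    using assms by (metis mult.left_commute mult_nonneg_nonneg)
  moreover have "f X = 0 \<and> 0 \<le> g X \<or> g X = 0 \<and> 0 \<le> f X"
    using X(2) by (auto simp: min_def split: if_splits)
  ultimately have "X \<in> closed_segment (vector [a, 0]) P \<union> closed_segment (vector [c, 0]) P"
    using on_side_of_triangle[of s P X a c] on_side_of_triangle[of s P X c a] assms \<open>p > 0\<close>
    by (auto simp: f_def g_def p_def algebra_simps)
  then show ?thesis using X(1) unfolding S_def by auto
qed

section \<open>A star forest\<close>

definition star_edges :: "nat \<Rightarrow> nat \<Rightarrow> nat set set" where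
  "star_edges k n = (\<lambda>v. {v mod k, v}) ` {k..<n}"

text \<open>The edge of leaf \<open>v\<close>, parametrized by height. Centres are \<open>n\<close>
  apart on the axis and the drift \<open>v div k\<close> to the right is smaller than
  \<open>n\<close>, so different stars occupy disjoint strips.\<close>

definition strand :: "nat \<Rightarrow> nat \<Rightarrow> nat \<Rightarrow> real \<Rightarrow> real^2" where
  "strand k n v t = vector [real (v mod k) * real n + t * real (v div k), t]"

text \<open>\<open>Max e\<close> recovers the leaf from the edge, since the centre is the smaller
  vertex.\<close>

definition star_drawing :: "nat \<Rightarrow> nat \<Rightarrow> nat drawing" where
  "star_drawing k n =
     \<lparr>verts = {..<n}, edges = star_edges k n,
      loc = (\<lambda>v. strand k n v (if v < k then 0 else 1)),
      curve = (\<lambda>e. strand k n (Max e))\<rparr>"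

text \<open>The second coordinate gives the height. The drift lies in [0, n), so the first
  coordinate determines the residue and then, at nonzero height, the quotient. All incidences in the
  star drawing are read off from this.\<close>

lemma strand_eqD:
  assumes "v < n" "w < n" "0 \<le> t" "t \<le> 1" "strand k n v t = strand k n w s"
  shows "t = s" "v mod k = w mod k" "t = 0 \<or> v = w"
proof -
  have eq: "real (v mod k) * n + t * real (v div k) = real (w mod k) * n + t * real (w div k)"
    and "t = s"
    using assms(5) by (auto simp: strand_def vec_eq_iff forall_2)
  have bound: "0 \<le> t * real (x div k)" "t * real (x div k) < n" if "x < n" for x
  proof -
    have "t * real (x div k) \<le> 1 * real (x div k)"
      using assms by (intro mult_right_mono) auto
    also have "\<dots> \<le> x" by simp
    also have "\<dots> < n" using that by simp
    finally show "t * real (x div k) < n" .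
  qed (use assms in auto)
  have gap: "real i * n + n \<le> real j * n" if "i < j" for i j :: nat
  proof -
    have "real (i + 1) * n \<le> real j * n"
      using that by (intro mult_right_mono) auto
    then show ?thesis by (simp add: algebra_simps)
  qed
  show "v mod k = w mod k"
    using gap[of "v mod k" "w mod k"] gap[of "w mod k" "v mod k"] eq
      bound[OF assms(1)] bound[OF assms(2)] by linarith
  then show "t = 0 \<or> v = w"
    using eq by (metis add_left_cancel div_mod_decomp mult_left_cancel of_nat_eq_iff)
  show "t = s" by fact
qed

lemma strand_eq_linepath: "strand k n v = linepath (strand k n v 0) (strand k n v 1)"
  by (rule ext) (simp add: strand_def linepath_def vec_eq_iff forall_2 algebra_simps)

lemma plane_graph_star_drawing:
  assumes "k > 0"
  shows "plane_graph (star_drawing k n)"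
proof -
  have Max: "Max {v mod k, v} = v" for v
    by (auto simp: max_def)
  have loc: "loc (star_drawing k n) v = strand k n v (if v < k then 0 else 1)" for v
    by (simp add: star_drawing_def)
  have start: "strand k n v 0 = loc (star_drawing k n) (v mod k)" for v
    using assms by (simp add: loc) (simp add: strand_def)
  have finish: "strand k n v 1 = loc (star_drawing k n) v" if "k \<le> v" for v
    using that by (simp add: loc)
  have inj: "inj_on (loc (star_drawing k n)) {..<n}"
  proof (rule inj_onI)
    fix v w assume vw: "v \<in> {..<n}" "w \<in> {..<n}"
      and "loc (star_drawing k n) v = loc (star_drawing k n) w"
    then have eq: "strand k n v (if v < k then 0 else 1) = strand k n w (if w < k then 0 else 1)"
      by (simp add: loc)
    have "v < n" "w < n" using vw by auto
    then have "v mod k = w mod k" "v < k \<longleftrightarrow> w < k" "v < k \<or> v = w"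
      using strand_eqD[OF _ _ _ _ eq] by (cases "v < k"; cases "w < k"; simp)+
    then show "v = w" by (metis mod_less)
  qed
  have arc: "arc (strand k n v)" for v
    by (subst strand_eq_linepath) (rule arc_linepath, simp add: strand_def vec_eq_iff forall_2)
  have on_vertex: "w = v mod k \<or> w = v"
    if v: "v \<in> {k..<n}" and w: "w < n" and
      on: "loc (star_drawing k n) w \<in> path_image (strand k n v)" for v w
  proof -
    obtain t where t: "0 \<le> t" "t \<le> 1" "strand k n v t = strand k n w (if w < k then 0 else 1)"
      using on by (auto simp: path_image_def loc)
    show ?thesis
      using strand_eqD[OF _ w t] v by (auto split: if_splits)
  qed
  have meet: "x \<in> loc (star_drawing k n) ` ({v mod k, v} \<inter> {w mod k, w})"
    if v: "v \<in> {k..<n}" and w: "w \<in> {k..<n}" and "v \<noteq> w"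
      and x: "x \<in> path_image (strand k n v)" "x \<in> path_image (strand k n w)" for v w x
  proof -
    obtain t s where t: "0 \<le> t" "t \<le> 1" "strand k n v t = strand k n w s" "x = strand k n v t"
      using x by (auto simp: path_image_def)
    have "t = 0" "v mod k = w mod k"
      using strand_eqD[OF _ _ t(1-3)] v w \<open>v \<noteq> w\<close> by auto
    then show ?thesis
      using t(4) start[of v] by auto
  qed
  have sel: "verts (star_drawing k n) = {..<n}" "edges (star_drawing k n) = star_edges k n"
    "curve (star_drawing k n) = (\<lambda>e. strand k n (Max e))"
    by (simp_all add: star_drawing_def)
  have simple: "simple_graph {..<n} (star_edges k n)"
  proof -
    have "v mod k \<noteq> v" "v mod k < n" if "k \<le> v" "v < n" for v
      using that mod_less_divisor[OF assms, of v] by linarith+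
    then show ?thesis
      by (auto simp: simple_graph_def star_edges_def card_insert_if)
  qed
  show ?thesis
    unfolding plane_graph_def sel
  proof (intro conjI ballI impI)
    fix e assume "e \<in> star_edges k n"
    then obtain v where v: "v \<in> {k..<n}" "e = {v mod k, v}" by (auto simp: star_edges_def)
    show "arc (strand k n (Max e))" by (rule arc)
    show "{pathstart (strand k n (Max e)), pathfinish (strand k n (Max e))}
        = loc (star_drawing k n) ` e"
      using v by (simp add: Max pathstart_def pathfinish_def start finish)
    show "path_image (strand k n (Max e)) \<inter> loc (star_drawing k n) ` {..<n}
        \<subseteq> loc (star_drawing k n) ` e"
      using on_vertex[OF v(1)] by (auto simp: v(2) Max)
  next
    fix e f assume "e \<in> star_edges k n" "f \<in> star_edges k n" "e \<noteq> f"
    obtain v where v: "v \<in> {k..<n}" "e = {v mod k, v}"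
      using \<open>e \<in> star_edges k n\<close> by (auto simp: star_edges_def)
    obtain w where w: "w \<in> {k..<n}" "f = {w mod k, w}"
      using \<open>f \<in> star_edges k n\<close> by (auto simp: star_edges_def)
    have "v \<noteq> w" using v w \<open>e \<noteq> f\<close> by blast
    show "path_image (strand k n (Max e)) \<inter> path_image (strand k n (Max f))
        \<subseteq> loc (star_drawing k n) ` (e \<inter> f)"
      unfolding v(2) w(2) Max using meet[OF v(1) w(1) \<open>v \<noteq> w\<close>] by blast
  qed (use inj simple in auto)
qed

lemma straight_line_star_drawing:
  assumes "k > 0"
  shows "straight_line (star_drawing k n)"
  unfolding straight_line_def
proof (intro allI impI)
  fix u v assume "{u, v} \<in> edges (star_drawing k n)"
  then obtain w where w: "k \<le> w" "{u, v} = {w mod k, w}"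
    by (auto simp: star_drawing_def star_edges_def)
  have "path_image (curve (star_drawing k n) {w mod k, w})
      = closed_segment (strand k n w 0) (strand k n w 1)"
    by (simp add: star_drawing_def max_def)
      (metis strand_eq_linepath path_image_linepath)
  also have "strand k n w 0 = loc (star_drawing k n) (w mod k)"
    using assms by (simp add: star_drawing_def) (simp add: strand_def)
  also have "strand k n w 1 = loc (star_drawing k n) w"
    using w by (simp add: star_drawing_def)
  finally show "path_image (curve (star_drawing k n) {u, v})
      = closed_segment (loc (star_drawing k n) u) (loc (star_drawing k n) v)"
    using w(2) by (auto simp: doubleton_eq_iff closed_segment_commute insert_commute)
qed

section \<open>Vertices that stay in place\<close>

text \<open>Edges of two different stars share no vertex, so their curves are disjoint in
  \<open>H\<close>; but the leaves alternate on the axis and the centres are on one side of it, so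
  \<open>alternating_wedges_meet\<close> makes two of the curves intersect.\<close>

lemma kept_leaves_not_alternating:
  fixes H :: "nat drawing"
  assumes H: "plane_graph H" "straight_line H" "edges H = star_edges k n"
    and at: "\<And>x. x \<in> {u, v, u', v'} \<Longrightarrow> loc H x = vector [real x, 0] \<and> k \<le> x \<and> x < n"
    and order: "u < v" "v < u'" "u' < v'"
    and stars: "u mod k = i" "u' mod k = i" "v mod k = j" "v' mod k = j" "i \<noteq> j" "i < k" "j < k"
    and side: "0 \<le> loc H i $ 2 \<longleftrightarrow> 0 \<le> loc H j $ 2"
  shows False
proof -
  have edge: "{x, x mod k} \<in> edges H" if "x \<in> {u, v, u', v'}" for x
    using at[OF that] by (auto simp: H star_edges_def insert_commute)
  have seg: "path_image (curve H {x, x mod k}) = closed_segment (vector [real x, 0]) (loc H (x mod k))"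
    if "x \<in> {u, v, u', v'}" for x
    using H(2) edge[OF that] at[OF that] by (simp add: straight_line_def)
  have disj: "path_image (curve H {x, x mod k}) \<inter> path_image (curve H {y, y mod k}) = {}"
    if "x \<in> {u, u'}" "y \<in> {v, v'}" for x y
  proof -
    have "{x, x mod k} \<inter> {y, y mod k} = {}"
      using that stars order at[of x] at[of y] by auto
    moreover from this have "{x, x mod k} \<noteq> {y, y mod k}" by blast
    moreover have "{x, x mod k} \<in> edges H" "{y, y mod k} \<in> edges H"
      using that by (auto intro!: edge)
    ultimately have "path_image (curve H {x, x mod k}) \<inter> path_image (curve H {y, y mod k})
        \<subseteq> loc H ` {}"
      using H(1) unfolding plane_graph_def by metis
    then show ?thesis by simp
  qed
  obtain s :: real where "s \<noteq> 0" "0 \<le> s * loc H i $ 2" "0 \<le> s * loc H j $ 2"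
  proof (cases "0 \<le> loc H i $ 2")
    case True
    then show ?thesis using side by (intro that[of 1]) auto
  next
    case False
    then show ?thesis using side by (intro that[of "-1"]) auto
  qed
  note wedges = alternating_wedges_meet[OF _ _ _ this, of "real u" "real v" "real u'" "real v'"]
  have segs: "path_image (curve H {u, u mod k}) = closed_segment (vector [real u, 0]) (loc H i)"
    "path_image (curve H {u', u' mod k}) = closed_segment (vector [real u', 0]) (loc H i)"
    "path_image (curve H {v, v mod k}) = closed_segment (vector [real v, 0]) (loc H j)"
    "path_image (curve H {v', v' mod k}) = closed_segment (vector [real v', 0]) (loc H j)"
    using seg[of u] seg[of u'] seg[of v] seg[of v'] stars by simp_all
  have "(path_image (curve H {u, u mod k}) \<union> path_image (curve H {u', u' mod k})) \<inter>
      (path_image (curve H {v, v mod k}) \<union> path_image (curve H {v', v' mod k})) \<noteq> {}"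
    unfolding segs using order by (intro wedges) simp_all
  then show False
    by (simp add: Int_Un_distrib Int_Un_distrib2 disj)
qed

text \<open>The centres and the first kept leaf of each star contribute at most
  \<open>2 * k\<close>. Every other kept leaf is determined by its \<open>code\<close>: the side of
  its centre, the round of the first kept leaf of its star, and its own round. Rounds range over 0,
  ..., \<open>n div k\<close>.\<close>

lemma card_kept_le:
  fixes H :: "nat drawing"
  assumes H: "plane_graph H" "straight_line H" "edges H = star_edges k n" and "k > 0"
  shows "card {v. v < n \<and> loc H v = vector [real v, 0]} \<le> 2 * k + 2 * (n div k + 1)\<^sup>2"
proof -
  define F where "F = {v. v < n \<and> loc H v = vector [real v, 0]}"
  define L where "L = {v \<in> F. k \<le> v}"
  define first where "first i = (LEAST v. v \<in> L \<and> v mod k = i)" for i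
  define L1 where "L1 = {v \<in> L. v = first (v mod k)}"
  define L2 where "L2 = L - L1"
  define code where
    "code v = (0 \<le> loc H (v mod k) $ 2, first (v mod k) div k, v div k)" for v
  have fin: "finite F" "finite L" by (auto simp: F_def L_def)
  have first: "first (v mod k) \<in> L" "first (v mod k) mod k = v mod k" "first (v mod k) \<le> v"
    if "v \<in> L" for v
    using LeastI[of "\<lambda>w. w \<in> L \<and> w mod k = v mod k" v] that
    by (auto simp: first_def intro: Least_le)
  have less_div: "x < y" if "x div k < y div k" for x y :: nat
    using that by (meson div_le_mono leD leI)
  have less_mod: "x < y" if "x div k = y div k" "x mod k < y mod k" for x y :: nat
    using that by (metis add_less_cancel_left mult_div_mod_eq)
  have no_clash: False
    if v: "v \<in> L2" and w: "w \<in> L2" and eq: "code v = code w" and less: "v mod k < w mod k" for v w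
  proof -
    have vL: "v \<in> L" "first (v mod k) \<noteq> v" and wL: "w \<in> L"
      using v w by (auto simp: L2_def L1_def)
    have div: "first (v mod k) div k < v div k"
    proof -
      \<comment> \<open>Two distinct leaves of one star have the same residue, so they differ in
        their round.\<close>
      have "first (v mod k) div k \<noteq> v div k"
        using first[OF vL(1)] vL(2) by (metis mult_div_mod_eq)
      then show ?thesis
        using div_le_mono[OF first(3)[OF vL(1)], of k] by linarith
    qed
    have e: "first (v mod k) div k = first (w mod k) div k" "v div k = w div k"
      "0 \<le> loc H (v mod k) $ 2 \<longleftrightarrow> 0 \<le> loc H (w mod k) $ 2"
      using eq by (simp_all add: code_def)
    \<comment> \<open>Equal codes put the two first leaves in one round and \<open>v\<close>,
      \<open>w\<close> in a later one; within a round the residue decides. So the leaves of the two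
      stars alternate.\<close>
    have order: "first (v mod k) < first (w mod k)" "first (w mod k) < v" "v < w"
      using e div first(2)[OF vL(1)] first(2)[OF wL] less
      by (auto intro: less_mod less_div)
    have at: "loc H x = vector [real x, 0] \<and> k \<le> x \<and> x < n"
      if "x \<in> {first (v mod k), first (w mod k), v, w}" for x
      using that first(1)[OF vL(1)] first(1)[OF wL] vL wL by (auto simp: L_def F_def)
    show False
      using kept_leaves_not_alternating[OF H at order, of "v mod k" "w mod k"]
        first(2)[OF vL(1)] first(2)[OF wL] e(3) less \<open>k > 0\<close> by simp
  qed
  have "inj_on code L2"
  proof (rule inj_onI)
    fix v w assume vw: "v \<in> L2" "w \<in> L2" "code v = code w"
    then have "v mod k = w mod k"
      using no_clash[of v w] no_clash[of w v] by (metis nat_neq_iff)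
    moreover have "v div k = w div k" using vw by (simp add: code_def)
    ultimately show "v = w" by (metis mult_div_mod_eq)
  qed
  moreover have "code ` L2 \<subseteq> UNIV \<times> {..n div k} \<times> {..n div k}"
  proof
    fix c assume "c \<in> code ` L2"
    then obtain v where "v \<in> L" "c = code v" by (auto simp: L2_def)
    then show "c \<in> UNIV \<times> {..n div k} \<times> {..n div k}"
      using first(1)[of v] by (auto simp: code_def L_def F_def intro!: div_le_mono)
  qed
  ultimately have "card L2 \<le> card ((UNIV :: bool set) \<times> {..n div k} \<times> {..n div k})"
    by (intro card_inj_on_le) auto
  then have "card L2 \<le> 2 * (n div k + 1)\<^sup>2"
    by (simp add: card_cartesian_product power2_eq_square)
  moreover have "card L1 \<le> card {..<k}"
  proof (rule card_inj_on_le)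
    show "inj_on (\<lambda>v. v mod k) L1"
      by (rule inj_onI) (metis (mono_tags, lifting) L1_def mem_Collect_eq)
  qed (use \<open>k > 0\<close> in auto)
  moreover have "card F \<le> card ({..<k} \<union> (L1 \<union> L2))"
    by (rule card_mono) (use fin in \<open>auto simp: L1_def L2_def L_def\<close>)
  moreover have "card ({..<k} \<union> (L1 \<union> L2)) \<le> card {..<k} + (card L1 + card L2)"
    by (meson add_left_mono card_Un_le le_trans)
  ultimately show ?thesis
    unfolding F_def by simp
qed

section \<open>Plane graphs with prescribed vertex locations\<close>

lemma plane_graph_continuous_injective_image:
  assumes G: "plane_graph G" and h: "continuous_on UNIV h" "inj h"
  shows "plane_graph (G\<lparr>loc := h \<circ> loc G, curve := \<lambda>e. h \<circ> curve G e\<rparr>)"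
proof -
  have h': "h x = h y \<longleftrightarrow> x = y" for x y using h(2) by (simp add: inj_eq)
  have arc: "arc (h \<circ> p)" if "arc p" for p
    using that h unfolding arc_def
    by (metis comp_inj_on continuous_on_subset inj_on_subset path_continuous_image subset_UNIV)
  define G' where "G' = G\<lparr>loc := h \<circ> loc G, curve := \<lambda>e. h \<circ> curve G e\<rparr>"
  have sel: "verts G' = verts G" "edges G' = edges G" "loc G' = h \<circ> loc G"
    "curve G' = (\<lambda>e. h \<circ> curve G e)"
    by (simp_all add: G'_def)
  have "plane_graph G'"
    unfolding plane_graph_def sel path_image_compose pathstart_compose pathfinish_compose
  proof (intro conjI ballI impI)
    show "simple_graph (verts G) (edges G)" using G by (simp add: plane_graph_def)
    show "inj_on (h \<circ> loc G) (verts G)"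
      using G h by (auto simp: plane_graph_def intro: comp_inj_on inj_on_subset)
  next
    fix e assume e: "e \<in> edges G"
    show "arc (h \<circ> curve G e)" using G e by (auto simp: plane_graph_def intro: arc)
    have "{pathstart (curve G e), pathfinish (curve G e)} = loc G ` e"
      using G e by (simp add: plane_graph_def)
    from arg_cong[OF this, of "image h"]
    show "{h (pathstart (curve G e)), h (pathfinish (curve G e))} = (h \<circ> loc G) ` e"
      by (simp add: image_comp)
    show "h ` path_image (curve G e) \<inter> (h \<circ> loc G) ` verts G \<subseteq> (h \<circ> loc G) ` e"
      unfolding image_comp[symmetric] image_Int[OF h(2), symmetric]
      using G e by (intro image_mono) (simp add: plane_graph_def)
  next
    fix e f assume "e \<in> edges G" "f \<in> edges G" "e \<noteq> f"
    then have "path_image (curve G e) \<inter> path_image (curve G f) \<subseteq> loc G ` (e \<inter> f)"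
      using G by (simp add: plane_graph_def)
    then show "h ` path_image (curve G e) \<inter> h ` path_image (curve G f) \<subseteq> (h \<circ> loc G) ` (e \<inter> f)"
      unfolding image_comp[symmetric] image_Int[OF h(2), symmetric] by (rule image_mono)
  qed
  then show ?thesis by (simp add: G'_def)
qed

text \<open>In the plane, a homeomorphism can carry finitely many distinct points to any prescribed
  distinct points at once; the edges follow as possibly bent arcs.\<close>

lemma exists_plane_graph_relocated:
  fixes G :: "'a drawing"
  assumes G: "plane_graph G" and q: "inj_on q (verts G)"
  shows "\<exists>G' :: 'a drawing. plane_graph G' \<and> verts G' = verts G \<and> edges G' = edges G \<and>
    (\<forall>v\<in>verts G. loc G' v = q v)"
proof -
  have "pairwise (\<lambda>i j. loc G i \<noteq> loc G j \<and> q i \<noteq> q j) (verts G)" "finite (verts G)"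
    using G q by (auto simp: pairwise_def plane_graph_def simple_graph_def dest: inj_onD)
  then obtain h h' where h: "homeomorphism UNIV UNIV h h'" "\<And>v. v \<in> verts G \<Longrightarrow> h (loc G v) = q v"
    by (rule_tac homeomorphism_moving_points_exists
        [of "UNIV :: (real^2) set" UNIV "verts G" "loc G" q]) auto
  have "plane_graph (G\<lparr>loc := h \<circ> loc G, curve := \<lambda>e. h \<circ> curve G e\<rparr>)"
    using h(1) by (intro plane_graph_continuous_injective_image[OF G])
      (auto simp: homeomorphism_def intro: inj_on_inverseI)
  then show ?thesis
    using h(2) by (intro exI[of _ "G\<lparr>loc := h \<circ> loc G, curve := \<lambda>e. h \<circ> curve G e\<rparr>"]) auto
qed

section \<open>Bounds for the maximal shift\<close>

lemma max_shift_lower: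
  assumes "k > 0"
  shows "n \<le> max_shift n + 2 * k + 2 * (n div k + 1)\<^sup>2"
proof -
  have sel: "verts (star_drawing k n) = {..<n}" "edges (star_drawing k n) = star_edges k n"
    by (simp_all add: star_drawing_def)
  have "inj_on (\<lambda>v. vector [real v, 0] :: real^2) {..<n}"
    by (auto simp: inj_on_def vec_eq_iff forall_2)
  then obtain G :: "nat drawing" where G: "plane_graph G" "verts G = {..<n}" "edges G = star_edges k n"
      and loc: "\<And>v. v < n \<Longrightarrow> loc G v = vector [real v, 0]"
    using exists_plane_graph_relocated[OF plane_graph_star_drawing[OF assms, of n]]
    unfolding sel by blast
  \<comment> \<open>The star drawing witnesses that straight line redrawings of \<open>G\<close>
    exist, so the minimum in \<open>shift G\<close> is attained, by \<open>H\<close> below.\<close>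
  have "straight_line_redrawing G (star_drawing k n)"
    using assms G plane_graph_star_drawing straight_line_star_drawing
    by (simp add: straight_line_redrawing_def sel)
  then have "\<exists>s H. straight_line_redrawing G H \<and> card (moved G H) = s" by blast
  from LeastI_ex[OF this]
  obtain H where H: "straight_line_redrawing G H" "card (moved G H) = shift G"
    unfolding shift_def by blast
  have "card {v. v < n \<and> loc H v = vector [real v, 0]} \<le> 2 * k + 2 * (n div k + 1)\<^sup>2"
    using H(1) G assms by (intro card_kept_le) (auto simp: straight_line_redrawing_def)
  moreover have "{..<n} = {v. v < n \<and> loc H v = vector [real v, 0]} \<union> moved G H"
    using G loc by (auto simp: moved_def)
  then have "n \<le> card {v. v < n \<and> loc H v = vector [real v, 0]} + card (moved G H)"
    by (metis card_Un_le card_lessThan)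
  moreover have "shift G \<le> max_shift n"
    unfolding max_shift_def using G by (intro Max_ge finite_shifts) auto
  ultimately show ?thesis using H(2) by linarith
qed

text \<open>
  The constant absorbs the unspecified value that \<open>shift\<close> takes on a plane graph without straight
  line redrawing, so that no appeal to the Wagner-Fary-Stein theorem is needed.
\<close>

lemma max_shift_upper: "max_shift n \<le> n + (LEAST s. False)"
proof -
  have "shift G \<le> n + (LEAST s. False)" if "plane_graph G" "card (verts G) = n" for G :: "nat drawing"
  proof (cases "\<exists>G'. straight_line_redrawing G G'")
    case True
    then show ?thesis using shift_le_card_verts that by fastforce
  next
    case False
    then have "shift G = (LEAST s. False)" by (simp add: shift_def)
    then show ?thesis by simp
  qed
  then show ?thesis
    unfolding max_shift_def using finite_shifts shifts_nonempty by (subst Max_le_iff) auto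
qed

theorem theorem1:
  shows "(\<lambda>n. real (max_shift n) / real n) \<longlonglongrightarrow> 1"
proof -
  define c where "c = real (LEAST s. False)"
  \<comment> \<open>The bound of \<open>max_shift_lower\<close> for \<open>k\<close> near n^(2/3):
    both the term linear in \<open>k\<close> and the squared number of rounds are then of order
    n^(2/3).\<close>
  define err where
    "err n = 2 * (real n powr (2/3) + 1) + 2 * (real n powr (1/3) + 1)\<^sup>2" for n :: nat
  show ?thesis
  proof (rule tendsto_sandwich[where f = "\<lambda>n. 1 - err n / real n"
        and h = "\<lambda>n. 1 + c / real n"])
    show "\<forall>\<^sub>F n in sequentially. real (max_shift n) / real n \<le> 1 + c / real n"
      using eventually_gt_at_top[of 0]
    proof eventually_elim
      case (elim n)
      have "real (max_shift n) \<le> real n + c"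
        unfolding c_def using max_shift_upper[of n] by (metis of_nat_add of_nat_mono)
      then show ?case using elim by (simp add: field_simps)
    qed
    show "(\<lambda>n. 1 + c / real n) \<longlonglongrightarrow> 1" by real_asymp
    show "\<forall>\<^sub>F n in sequentially. 1 - err n / real n \<le> real (max_shift n) / real n"
      using eventually_gt_at_top[of 0]
    proof eventually_elim
      case (elim n)
      define A where "A k = (real (n div k) + 1)\<^sup>2" for k
      define B where "B = (real n powr (1/3) + 1)\<^sup>2"
      \<comment> \<open>Rounding up ensures that \<open>n div k\<close> is at most n^(1/3), at the
        cost of the 1 added to n^(2/3) in \<open>err\<close>.\<close>
      define k where "k = nat \<lceil>real n powr (2/3)\<rceil>"
      have pos: "real n powr (2/3) > 0" using elim by simp
      then have k: "real n powr (2/3) \<le> real k" "real k \<le> real n powr (2/3) + 1"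
        unfolding k_def by linarith+
      then have "k > 0" using pos by linarith
      have "real (n div k) \<le> real n / real k"
        by (rule of_nat_div_le_of_nat)
      also have "\<dots> \<le> real n / real n powr (2/3)"
        using k pos \<open>k > 0\<close> by (intro divide_left_mono) auto
      also have "\<dots> = real n powr (1/3)"
        using elim powr_diff[of "real n" 1 "2/3"] by simp
      finally have "A k \<le> B"
        unfolding A_def B_def by (intro power_mono) auto
      moreover have "real n \<le> real (max_shift n) + 2 * real k + 2 * A k"
        unfolding A_def using of_nat_mono[OF max_shift_lower[OF \<open>k > 0\<close>, of n], where 'a = real]
        by (simp add: add.commute)
      ultimately have "real n - err n \<le> real (max_shift n)"
        using k unfolding err_def B_def[symmetric] by (simp add: algebra_simps)
      then have "(real n - err n) / real n \<le> real (max_shift n) / real n"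
        by (rule divide_right_mono) simp
      then show ?case using elim by (simp add: diff_divide_distrib)
    qed
    show "(\<lambda>n. 1 - err n / real n) \<longlonglongrightarrow> 1"
      unfolding err_def by real_asymp
  qed
qed

end
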